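(* Let $\gamma$ be a sufficiently rich intersection context with no failures, and let $P$ be an intersection protocol for $\gamma$. If $P$ is lexicographically optimal with respect to $\gamma$ and $P$ depends only on agents in the front of their queues, then $P$ has no unnecessary waiting with respect to $\gamma$.
   Context: **Setting.** $\mathrm{Ag}\subseteq\mathbb N$ is a (possibly infinite) set of agents. Lanes $\mathcal L=\{0,\dots,\ell-1\}$ are partitioned into incoming lanes $\mathcal L_{in}=\{0,\dots,k-1\}$ ($1<k<\ell$) and outgoing lanes $\mathcal L_{out}$. A move is an element of $\mathcal L_{in}\times\mathcal L_{out}$. A symmetric relation $\mathcal O\subseteq(\mathcal L_{in}\times\mathcal L_{out})^2$ is fixed; two moves are compatible if the pair is in $\mathcal O$. **Adversaries.** A transmission environment is $T\subseteq(\mathcal L_{in}\times\mathbb N)^2$ with $((l,0),(l',0))\in T$ for all $l,l'\in\mathcal L_{in}$. An adversary is $\alpha=(\tau,T,F_t,F_r)$ with $\tau:\mathrm{Ag}\to\mathbb N\times\mathcal L_{in}\times\mathcal L_{out}$ (arrival time, arrival lane, intended departure lane), where distinct agents with the same arrival time have different arrival lanes; $T$ a transmission environment; $F_t,F_r:\mathbb N\times\mathrm{Ag}\to\{0,1\}$ (value $0$ at $(m,i)$: $i$'s transmitter, resp. receiver, fails in round $m+1$, i.e. between times $m$ and $m+1$). An adversary model $\mathcal F$ is a set of adversaries. "No failures" means that $\mathcal F$ is the set of all adversaries with $F_t\equiv F_r\equiv1$, or the set of all such adversaries having one fixed transmission environment $T$. **Intersection contexts.** An environment state is $s_e=(\alpha,t,(q_l)_{l\in\mathcal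 L_{in}},\mathit{done})$: an adversary $\alpha\in\mathcal F$, a time $t\in\mathbb N$, a queue $q_l$ of agents per incoming lane, and a set $\mathit{done}\subseteq\mathrm{Ag}$. $\mathit{pos}_i=p$ if $i$ is in position $p$ of some queue (front is position $0$), $\top$ if $i\in\mathit{done}$, $\bot$ otherwise. Agent $i$'s sensor reading $\mathscr S_i(s_e)\in\Sigma_i$ contains $\mathit{front}_i$ ($=1$ iff $\mathit{pos}_i=0$), $\mathit{lane}_i$ ($=l$ if $i$ is in $q_l$, $\top$ if $i\in\mathit{done}$, $\bot$ otherwise) and $\mathit{intent}_i$ (the departure lane in $\tau(i)$), and possibly further components that are functions of $s_e$ (such as the time). An information-exchange protocol $\mathcal E$ gives for each agent $i$: a set $\mathit{Mem}_i$ of memory states with a subset of initial ones, local states $L_i=\mathit{Mem}_i\times\Sigma_i$, actions $A_i=\{\mathtt{go},\mathtt{noop}\}$, messages $M_i$, $\mu_i:L_i\times A_i\times\Sigma_i\to M_i\cup\{\bot\}$ ($\bot$: no message) and $\delta_i:L_i\times A_i\times\mathcal P(\bigcup_jM_j)\to\mathit{Mem}_i$. An intersection context is $\gamma=(\mathcal E,\mathcal F,\pi)$, where $\pi$ interprets atomic propositions about $\mathit{front}_i,\mathit{lane}_i,\mathit{intent}_i,\mathit{pos}_i$ according to the global state. An action protocol $P$ for $\gamma$ consists of maps $P_i:L_i\to A_i$; $\mathtt{go}$ can be performed only by an agent at the front of its queue ($P_i(s)=\mathtt{go}$ only if $\mathit{front}_i=1$ in $s$). **Sufficiently rich.** $\gamma$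 is sufficiently rich if: (1) in each round $m$, if agent $i$ is going to be at the front of some lane at time $m$ (i.e. its new sensor reading has $\mathit{front}_i=1$), then $i$ broadcasts in round $m$ a message encoding $\mathit{lane}_i$ and $\mathit{intent}_i$; (2) each agent records in its memory the $(\mathit{lane},\mathit{intent})$ pair received for each agent in the front of a queue, and either no agents other than those at the front of a queue broadcast, or agents at the front of a queue tag their messages to indicate that they are at the front. **Runs.** Global states are $(s_e,(s_i)_{i\in\mathrm{Ag}})$. Initially $t=0$, all queues and $\mathit{done}$ are empty, and $s_i=(u_i,\mathscr S_i(s_e))$ with $u_i$ an initial memory state. In round $m+1$: each $i$ performs $P_i(s_i)$; each agent at the front of a queue performing $\mathtt{go}$ is dequeued and added to $\mathit{done}$; then each agent $i$ with $\tau(i)=(m+1,l,l')$ is appended to $q_l$; time becomes $m+1$ and $\alpha$ is unchanged, giving $s_e'$. Each $i$ broadcasts $m_i=\mu_i(s_i,P_i(s_i),\mathscr S_i(s_e'))$. $B_i=\emptyset$ if $i$ is in no queue in $s'_e$ or $F_r(m,i)=0$; otherwise $B_i$ is the set of (non-$\bot$) $m_j$ for agents $j$ in some queue with ((lane, position) of $j$, (lane, position) of $i$)$\,\in T$ (in $s'_e$) and $F_t(m,j)=1$. The new local state is $s_i'=(\delta_i(s_i,P_i(s_i),B_i),\mathscr S_i(s'_e))$. $\mathcal I_{\gamma,P}$ is the interpreted system of all such runs $r:\mathbb N\to$ global states; $r_i(m)$ is $i$'s local state at point $(r,m)$. $\bigcirc\phi$ holds at $(r,m)$ iff $\phi$ holds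 at $(r,m+1)$; $\Diamond\phi$ iff $\phi$ holds at some $(r,m')$, $m'\ge m$. A formula is valid if it holds at all points. **Intersection protocol.** $\mathit{going}_i:=\mathit{front}_i\wedge\bigcirc\neg\mathit{front}_i$. $P$ is an intersection protocol for $\gamma$ if for all $i\ne j$ these are valid in $\mathcal I_{\gamma,P}$: Validity $\mathit{going}_i\Rightarrow\mathit{front}_i$; Safety $(\mathit{going}_i\wedge\mathit{going}_j)\Rightarrow((\mathit{lane}_i,\mathit{intent}_i),(\mathit{lane}_j,\mathit{intent}_j))\in\mathcal O$; Liveness $\mathit{front}_i\Rightarrow\Diamond\mathit{going}_i$. **Dependence on the front.** $\mathit{front}(r,m)$ is the set of agents $i$ with $\mathit{front}_i=1$ at $(r,m)$. $P$ depends only on agents in the front of their queues if for all agents $i$ and all points $(r,m),(r',m')$ of $\mathcal I_{\gamma,P}$: if $\mathit{front}(r,m)=\mathit{front}(r',m')$ then $P_i(r_i(m))=P_i(r'_i(m'))$. **Unnecessary waiting.** $GO(r,m)$ is the set of agents $i$ with $\mathit{going}_i$ true at $(r,m)$. $\mathit{safe\text{-}to\text{-}go}_i$ holds at $(r,m)$ if $\mathit{pos}_i=0$ there and for all distinct $j,k\in GO(r,m)\cup\{i\}$ the moves $(\mathit{lane}_j,\mathit{intent}_j)$ and $(\mathit{lane}_k,\mathit{intent}_k)$ at $(r,m)$ are compatible. $P$ has unnecessary waiting w.r.t. $\gamma$ if there are an agent $i$ and a point $(r,m)$ of $\mathcal I_{\gamma,P}$ with $\mathit{safe\text{-}to\text{-}go}_i$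 true at $(r,m)$ and $i\notin GO(r,m)$. **Lexicographic optimality.** Runs $r$ of $\mathcal I_{\gamma,P}$ and $r'$ of $\mathcal I_{\gamma,P'}$ correspond if $r(0)=r'(0)$. $P$ lexicographically dominates $P'$ w.r.t. $\gamma$ if for all corresponding runs $r$ of $P$ and $r'$ of $P'$, either $GO(r,m)=GO(r',m)$ for all $m$, or at the first $m$ with $GO(r,m)\neq GO(r',m)$ we have $GO(r',m)\subsetneq GO(r,m)$; strictly if also $P'$ does not lexicographically dominate $P$. An intersection protocol $P$ is lexicographically optimal w.r.t. $\gamma$ if no intersection protocol for $\gamma$ strictly lexicographically dominates $P$. *)

theory Defs
  imports "HOL-Library.FuncSet"
begin

type_synonym agent = nat
type_synonym lane = nat
type_synonym move = "lane \<times> lane"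

datatype action = Go | Noop

text \<open>Value of \<open>pos\<close> and \<open>lane\<close>: \<^term>\<open>Gone\<close> stands for \<open>\<top>\<close>, \<^term>\<open>Absent\<close> for \<open>\<bottom>\<close>.\<close>

datatype 'a status = At 'a | Gone | Absent

text \<open>
  \<open>arrival\<close> is \<open>\<tau>\<close> (time, arrival lane, departure lane). \<open>tx_ok (m, i)\<close> and \<open>rx_ok (m, i)\<close> are
  \<open>F_t\<close> and \<open>F_r\<close>, with \<^term>\<open>False\<close> (i.e. 0) meaning failure in round \<open>m + 1\<close>.
\<close>

record adversary =
  arrival :: "agent \<Rightarrow> nat \<times> lane \<times> lane"
  transmission :: "((lane \<times> nat) \<times> (lane \<times> nat)) set"
  tx_ok :: "nat \<times> agent \<Rightarrow> bool"
  rx_ok :: "nat \<times> agent \<Rightarrow> bool"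

record env =
  adv :: adversary
  clock :: nat
  queue :: "lane \<Rightarrow> agent list"
  departed :: "agent set"

record 'x reading =
  rd_front :: bool
  rd_lane :: "lane status"
  rd_intent :: lane
  rd_extra :: 'x

type_synonym ('mem, 'x) local_state = "'mem \<times> 'x reading"

text \<open>
  \<open>Reading i\<close> is \<open>\<Sigma>\<^sub>i\<close>; \<open>sense i\<close> gives the further components of the sensor reading, as an
  arbitrary function of the environment state. The result \<^term>\<open>None\<close> of \<open>mu\<close> means that no
  message is sent.
\<close>

record ('mem, 'msg, 'x) exchange =
  Mem :: "agent \<Rightarrow> 'mem set"
  Init :: "agent \<Rightarrow> 'mem set"
  Reading :: "agent \<Rightarrow> 'x reading set"
  sense :: "agent \<Rightarrow> env \<Rightarrow> 'x"
  Msg :: "agent \<Rightarrow> 'msg set"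
  mu :: "agent \<Rightarrow> ('mem, 'x) local_state \<Rightarrow> action \<Rightarrow> 'x reading \<Rightarrow> 'msg option"
  delta :: "agent \<Rightarrow> ('mem, 'x) local_state \<Rightarrow> action \<Rightarrow> 'msg set \<Rightarrow> 'mem"

text \<open>
  The ambient data of the intersection (agents, \<open>\<ell>\<close>, \<open>k\<close>, the compatibility relation \<open>\<O>\<close>) are
  kept in the same record as the information exchange and the adversary model. The interpretation
  \<open>\<pi>\<close> has no field: the atomic propositions are read off the environment state, below.
\<close>

record ('mem, 'msg, 'x) ctxt =
  agents :: "agent set"
  num_lanes :: nat
  num_in :: nat
  compat :: "(move \<times> move) set"
  exch :: "('mem, 'msg, 'x) exchange"
  model :: "adversary set"

type_synonym ('mem, 'x) gstate = "env \<times> (agent \<Rightarrow> ('mem, 'x) local_state)"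
type_synonym ('mem, 'x) run = "nat \<Rightarrow> ('mem, 'x) gstate"
type_synonym ('mem, 'x) protocol = "agent \<Rightarrow> ('mem, 'x) local_state \<Rightarrow> action"
type_synonym ('mem, 'x) formula = "('mem, 'x) run \<Rightarrow> nat \<Rightarrow> bool"


section \<open>Adversaries and environment states\<close>

definition in_lanes :: "('mem, 'msg, 'x) ctxt \<Rightarrow> lane set" where
  "in_lanes \<gamma> = {0..<num_in \<gamma>}"

definition out_lanes :: "('mem, 'msg, 'x) ctxt \<Rightarrow> lane set" where
  "out_lanes \<gamma> = {num_in \<gamma>..<num_lanes \<gamma>}"

definition moves :: "('mem, 'msg, 'x) ctxt \<Rightarrow> move set" where
  "moves \<gamma> = in_lanes \<gamma> \<times> out_lanes \<gamma>"

definition transmission_env ::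
  "('mem, 'msg, 'x) ctxt \<Rightarrow> ((lane \<times> nat) \<times> (lane \<times> nat)) set \<Rightarrow> bool" where
  "transmission_env \<gamma> T \<longleftrightarrow>
     T \<subseteq> (in_lanes \<gamma> \<times> UNIV) \<times> (in_lanes \<gamma> \<times> UNIV) \<and>
     (\<forall>l\<in>in_lanes \<gamma>. \<forall>l'\<in>in_lanes \<gamma>. ((l, 0), (l', 0)) \<in> T)"

text \<open>
  Functions on the agents are extensional, so that equality of adversaries and of global states
  ignores numbers that are not agents.
\<close>

definition is_adversary :: "('mem, 'msg, 'x) ctxt \<Rightarrow> adversary \<Rightarrow> bool" where
  "is_adversary \<gamma> \<alpha> \<longleftrightarrow>
     arrival \<alpha> \<in> agents \<gamma> \<rightarrow>\<^sub>E UNIV \<times> in_lanes \<gamma> \<times> out_lanes \<gamma> \<and>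
     (\<forall>i\<in>agents \<gamma>. \<forall>j\<in>agents \<gamma>. i \<noteq> j \<and> fst (arrival \<alpha> i) = fst (arrival \<alpha> j) \<longrightarrow>
        fst (snd (arrival \<alpha> i)) \<noteq> fst (snd (arrival \<alpha> j))) \<and>
     transmission_env \<gamma> (transmission \<alpha>) \<and>
     tx_ok \<alpha> \<in> UNIV \<times> agents \<gamma> \<rightarrow>\<^sub>E UNIV \<and>
     rx_ok \<alpha> \<in> UNIV \<times> agents \<gamma> \<rightarrow>\<^sub>E UNIV"

definition failure_free :: "('mem, 'msg, 'x) ctxt \<Rightarrow> adversary \<Rightarrow> bool" where
  "failure_free \<gamma> \<alpha> \<longleftrightarrow> is_adversary \<gamma> \<alpha> \<and> (\<forall>m. \<forall>i\<in>agents \<gamma>. tx_ok \<alpha> (m, i) \<and> rx_ok \<alpha> (m, i))"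

definition no_failures :: "('mem, 'msg, 'x) ctxt \<Rightarrow> bool" where
  "no_failures \<gamma> \<longleftrightarrow>
     model \<gamma> = {\<alpha>. failure_free \<gamma> \<alpha>} \<or>
     (\<exists>T. transmission_env \<gamma> T \<and> model \<gamma> = {\<alpha>. failure_free \<gamma> \<alpha> \<and> transmission \<alpha> = T})"

definition env_state :: "('mem, 'msg, 'x) ctxt \<Rightarrow> env \<Rightarrow> bool" where
  "env_state \<gamma> e \<longleftrightarrow>
     adv e \<in> model \<gamma> \<and>
     (\<forall>l. set (queue e l) \<subseteq> agents \<gamma>) \<and> (\<forall>l. l \<notin> in_lanes \<gamma> \<longrightarrow> queue e l = []) \<and>
     departed e \<subseteq> agents \<gamma>"

definition in_queue_at :: "('mem, 'msg, 'x) ctxt \<Rightarrow> env \<Rightarrow> agent \<Rightarrow> lane \<Rightarrow> nat \<Rightarrow> bool" where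
  "in_queue_at \<gamma> e i l p \<longleftrightarrow> l \<in> in_lanes \<gamma> \<and> p < length (queue e l) \<and> queue e l ! p = i"

definition in_queue :: "('mem, 'msg, 'x) ctxt \<Rightarrow> env \<Rightarrow> agent \<Rightarrow> bool" where
  "in_queue \<gamma> e i \<longleftrightarrow> (\<exists>l p. in_queue_at \<gamma> e i l p)"

text \<open>In every reachable state an agent has at most one lane and position.\<close>

definition pos :: "('mem, 'msg, 'x) ctxt \<Rightarrow> env \<Rightarrow> agent \<Rightarrow> nat status" where
  "pos \<gamma> e i =
     (if in_queue \<gamma> e i then At (THE p. \<exists>l. in_queue_at \<gamma> e i l p)
      else if i \<in> departed e then Gone else Absent)"

definition lane_of :: "('mem, 'msg, 'x) ctxt \<Rightarrow> env \<Rightarrow> agent \<Rightarrow> lane status" where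
  "lane_of \<gamma> e i =
     (if in_queue \<gamma> e i then At (THE l. \<exists>p. in_queue_at \<gamma> e i l p)
      else if i \<in> departed e then Gone else Absent)"

definition intent :: "env \<Rightarrow> agent \<Rightarrow> lane" where
  "intent e i = snd (snd (arrival (adv e) i))"

definition at_front :: "('mem, 'msg, 'x) ctxt \<Rightarrow> env \<Rightarrow> agent \<Rightarrow> bool" where
  "at_front \<gamma> e i \<longleftrightarrow> pos \<gamma> e i = At 0"

definition sensor :: "('mem, 'msg, 'x) ctxt \<Rightarrow> agent \<Rightarrow> env \<Rightarrow> 'x reading" where
  "sensor \<gamma> i e =
     \<lparr>rd_front = at_front \<gamma> e i, rd_lane = lane_of \<gamma> e i, rd_intent = intent e i,
      rd_extra = sense (exch \<gamma>) i e\<rparr>"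

definition compatible :: "('mem, 'msg, 'x) ctxt \<Rightarrow> env \<Rightarrow> agent \<Rightarrow> agent \<Rightarrow> bool" where
  "compatible \<gamma> e i j \<longleftrightarrow>
     (\<exists>l l'. lane_of \<gamma> e i = At l \<and> lane_of \<gamma> e j = At l' \<and>
        ((l, intent e i), (l', intent e j)) \<in> compat \<gamma>)"


section \<open>Intersection contexts and action protocols\<close>

definition local_states :: "('mem, 'msg, 'x) ctxt \<Rightarrow> agent \<Rightarrow> ('mem, 'x) local_state set" where
  "local_states \<gamma> i = Mem (exch \<gamma>) i \<times> Reading (exch \<gamma>) i"

definition wf_exchange :: "('mem, 'msg, 'x) ctxt \<Rightarrow> bool" where
  "wf_exchange \<gamma> \<longleftrightarrow>
     (\<forall>i\<in>agents \<gamma>.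
        Init (exch \<gamma>) i \<subseteq> Mem (exch \<gamma>) i \<and>
        (\<forall>e. env_state \<gamma> e \<longrightarrow> sensor \<gamma> i e \<in> Reading (exch \<gamma>) i) \<and>
        (\<forall>s\<in>local_states \<gamma> i. \<forall>a. \<forall>\<sigma>\<in>Reading (exch \<gamma>) i.
           set_option (mu (exch \<gamma>) i s a \<sigma>) \<subseteq> Msg (exch \<gamma>) i) \<and>
        (\<forall>s\<in>local_states \<gamma> i. \<forall>a. \<forall>B \<subseteq> (\<Union>j\<in>agents \<gamma>. Msg (exch \<gamma>) j).
           delta (exch \<gamma>) i s a B \<in> Mem (exch \<gamma>) i))"

definition intersection_context :: "('mem, 'msg, 'x) ctxt \<Rightarrow> bool" where
  "intersection_context \<gamma> \<longleftrightarrow>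
     1 < num_in \<gamma> \<and> num_in \<gamma> < num_lanes \<gamma> \<and>
     compat \<gamma> \<subseteq> moves \<gamma> \<times> moves \<gamma> \<and> sym (compat \<gamma>) \<and>
     (\<forall>\<alpha>\<in>model \<gamma>. is_adversary \<gamma> \<alpha>) \<and>
     wf_exchange \<gamma>"

definition action_protocol :: "('mem, 'msg, 'x) ctxt \<Rightarrow> ('mem, 'x) protocol \<Rightarrow> bool" where
  "action_protocol \<gamma> P \<longleftrightarrow>
     (\<forall>i\<in>agents \<gamma>. \<forall>s\<in>local_states \<gamma> i. P i s = Go \<longrightarrow> rd_front (snd s))"


section \<open>Runs\<close>

definition initial :: "('mem, 'msg, 'x) ctxt \<Rightarrow> ('mem, 'x) gstate \<Rightarrow> bool" where
  "initial \<gamma> g \<longleftrightarrow>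
     adv (fst g) \<in> model \<gamma> \<and> clock (fst g) = 0 \<and>
     queue (fst g) = (\<lambda>_. []) \<and> departed (fst g) = {} \<and>
     snd g \<in> (\<Pi>\<^sub>E i\<in>agents \<gamma>. Init (exch \<gamma>) i \<times> {sensor \<gamma> i (fst g)})"

text \<open>
  For an adversary, at most one agent arrives in a given lane at a given time, so the list of
  arrivals below has length at most 1.
\<close>

definition env_step :: "('mem, 'msg, 'x) ctxt \<Rightarrow> (agent \<Rightarrow> action) \<Rightarrow> env \<Rightarrow> env" where
  "env_step \<gamma> act e = e\<lparr>
     clock := clock e + 1,
     queue := (\<lambda>l.
       (if queue e l \<noteq> [] \<and> act (hd (queue e l)) = Go then tl (queue e l) else queue e l) @
       sorted_list_of_set {i \<in> agents \<gamma>. \<exists>l'. arrival (adv e) i = (clock e + 1, l, l')}),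
     departed := departed e \<union> {i \<in> agents \<gamma>. at_front \<gamma> e i \<and> act i = Go}\<rparr>"

definition act :: "('mem, 'x) protocol \<Rightarrow> ('mem, 'x) gstate \<Rightarrow> agent \<Rightarrow> action" where
  "act P g i = P i (snd g i)"

definition next_env :: "('mem, 'msg, 'x) ctxt \<Rightarrow> ('mem, 'x) protocol \<Rightarrow> ('mem, 'x) gstate \<Rightarrow> env" where
  "next_env \<gamma> P g = env_step \<gamma> (act P g) (fst g)"

text \<open>The message that \<open>i\<close> broadcasts in the round that starts in the global state \<open>g\<close>.\<close>

definition broadcast ::
  "('mem, 'msg, 'x) ctxt \<Rightarrow> ('mem, 'x) protocol \<Rightarrow> ('mem, 'x) gstate \<Rightarrow> agent \<Rightarrow> 'msg option" where
  "broadcast \<gamma> P g i = mu (exch \<gamma>) i (snd g i) (act P g i) (sensor \<gamma> i (next_env \<gamma> P g))"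

text \<open>\<open>delivered \<gamma> P g j i b\<close>: in that round \<open>j\<close> broadcasts \<open>b\<close>, and \<open>i\<close> receives it.\<close>

definition delivered ::
  "('mem, 'msg, 'x) ctxt \<Rightarrow> ('mem, 'x) protocol \<Rightarrow> ('mem, 'x) gstate \<Rightarrow>
     agent \<Rightarrow> agent \<Rightarrow> 'msg \<Rightarrow> bool" where
  "delivered \<gamma> P g j i b \<longleftrightarrow>
     j \<in> agents \<gamma> \<and> broadcast \<gamma> P g j = Some b \<and>
     (\<exists>l p l' p'.
        in_queue_at \<gamma> (next_env \<gamma> P g) j l p \<and> in_queue_at \<gamma> (next_env \<gamma> P g) i l' p' \<and>
        ((l, p), (l', p')) \<in> transmission (adv (fst g))) \<and>
     tx_ok (adv (fst g)) (clock (fst g), j) \<and>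
     rx_ok (adv (fst g)) (clock (fst g), i)"

definition received ::
  "('mem, 'msg, 'x) ctxt \<Rightarrow> ('mem, 'x) protocol \<Rightarrow> ('mem, 'x) gstate \<Rightarrow> agent \<Rightarrow> 'msg set" where
  "received \<gamma> P g i = {b. \<exists>j. delivered \<gamma> P g j i b}"

definition step ::
  "('mem, 'msg, 'x) ctxt \<Rightarrow> ('mem, 'x) protocol \<Rightarrow> ('mem, 'x) gstate \<Rightarrow> ('mem, 'x) gstate" where
  "step \<gamma> P g =
     (next_env \<gamma> P g,
      \<lambda>i\<in>agents \<gamma>. (delta (exch \<gamma>) i (snd g i) (act P g i) (received \<gamma> P g i),
                   sensor \<gamma> i (next_env \<gamma> P g)))"

definition runs :: "('mem, 'msg, 'x) ctxt \<Rightarrow> ('mem, 'x) protocol \<Rightarrow> ('mem, 'x) run set" where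
  "runs \<gamma> P = {r. initial \<gamma> (r 0) \<and> (\<forall>m. r (Suc m) = step \<gamma> P (r m))}"


section \<open>Sufficiently rich contexts\<close>

text \<open>
  \<open>dec\<close> extracts the encoded lane and intent from a message; \<open>recd i\<close> extracts from \<open>i\<close>'s memory,
  for each agent \<open>j\<close> at the front of a queue, the pair that \<open>i\<close> received from \<open>j\<close> in the round just
  completed. The requirements concern all rounds of all runs of all action protocols.
\<close>

definition broadcasts_at_front ::
  "('mem, 'msg, 'x) ctxt \<Rightarrow> ('msg \<Rightarrow> move) \<Rightarrow> bool" where
  "broadcasts_at_front \<gamma> dec \<longleftrightarrow>
     (\<forall>P r m. \<forall>i\<in>agents \<gamma>.
        action_protocol \<gamma> P \<and> r \<in> runs \<gamma> P \<and> at_front \<gamma> (fst (r (Suc m))) i \<longrightarrow>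
        (\<exists>b l. broadcast \<gamma> P (r m) i = Some b \<and>
           lane_of \<gamma> (fst (r (Suc m))) i = At l \<and>
           dec b = (l, intent (fst (r (Suc m))) i)))"

definition records_front ::
  "('mem, 'msg, 'x) ctxt \<Rightarrow> ('msg \<Rightarrow> move) \<Rightarrow> (agent \<Rightarrow> 'mem \<Rightarrow> agent \<Rightarrow> move option) \<Rightarrow> bool" where
  "records_front \<gamma> dec recd \<longleftrightarrow>
     (\<forall>P r m. \<forall>i\<in>agents \<gamma>. \<forall>j v.
        action_protocol \<gamma> P \<and> r \<in> runs \<gamma> P \<longrightarrow>
        (recd i (fst (snd (r (Suc m)) i)) j = Some v \<longleftrightarrow>
           at_front \<gamma> (fst (r (Suc m))) j \<and> (\<exists>b. delivered \<gamma> P (r m) j i b \<and> dec b = v)))"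

definition only_front_broadcasts :: "('mem, 'msg, 'x) ctxt \<Rightarrow> bool" where
  "only_front_broadcasts \<gamma> \<longleftrightarrow>
     (\<forall>P r m. \<forall>i\<in>agents \<gamma>.
        action_protocol \<gamma> P \<and> r \<in> runs \<gamma> P \<and> \<not> at_front \<gamma> (fst (r (Suc m))) i \<longrightarrow>
        broadcast \<gamma> P (r m) i = None)"

definition front_tagged :: "('mem, 'msg, 'x) ctxt \<Rightarrow> ('msg \<Rightarrow> bool) \<Rightarrow> bool" where
  "front_tagged \<gamma> tag \<longleftrightarrow>
     (\<forall>P r m. \<forall>i\<in>agents \<gamma>. \<forall>b.
        action_protocol \<gamma> P \<and> r \<in> runs \<gamma> P \<and> broadcast \<gamma> P (r m) i = Some b \<longrightarrow>
        (tag b \<longleftrightarrow> at_front \<gamma> (fst (r (Suc m))) i))"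

definition sufficiently_rich :: "('mem, 'msg, 'x) ctxt \<Rightarrow> bool" where
  "sufficiently_rich \<gamma> \<longleftrightarrow>
     (\<exists>dec recd. broadcasts_at_front \<gamma> dec \<and> records_front \<gamma> dec recd) \<and>
     (only_front_broadcasts \<gamma> \<or> (\<exists>tag. front_tagged \<gamma> tag))"


section \<open>Intersection protocols\<close>

definition Next :: "('mem, 'x) formula \<Rightarrow> ('mem, 'x) formula" where
  "Next \<phi> r m = \<phi> r (m + 1)"

definition Eventually :: "('mem, 'x) formula \<Rightarrow> ('mem, 'x) formula" where
  "Eventually \<phi> r m = (\<exists>m'\<ge>m. \<phi> r m')"

definition valid ::
  "('mem, 'msg, 'x) ctxt \<Rightarrow> ('mem, 'x) protocol \<Rightarrow> ('mem, 'x) formula \<Rightarrow> bool" where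
  "valid \<gamma> P \<phi> \<longleftrightarrow> (\<forall>r\<in>runs \<gamma> P. \<forall>m. \<phi> r m)"

definition front :: "('mem, 'msg, 'x) ctxt \<Rightarrow> agent \<Rightarrow> ('mem, 'x) formula" where
  "front \<gamma> i r m \<longleftrightarrow> at_front \<gamma> (fst (r m)) i"

definition going :: "('mem, 'msg, 'x) ctxt \<Rightarrow> agent \<Rightarrow> ('mem, 'x) formula" where
  "going \<gamma> i r m \<longleftrightarrow> front \<gamma> i r m \<and> Next (\<lambda>r m. \<not> front \<gamma> i r m) r m"

definition intersection_protocol :: "('mem, 'msg, 'x) ctxt \<Rightarrow> ('mem, 'x) protocol \<Rightarrow> bool" where
  "intersection_protocol \<gamma> P \<longleftrightarrow>
     action_protocol \<gamma> P \<and>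
     (\<forall>i\<in>agents \<gamma>. valid \<gamma> P (\<lambda>r m. going \<gamma> i r m \<longrightarrow> front \<gamma> i r m)) \<and>
     (\<forall>i\<in>agents \<gamma>. \<forall>j\<in>agents \<gamma>. i \<noteq> j \<longrightarrow>
        valid \<gamma> P (\<lambda>r m. going \<gamma> i r m \<and> going \<gamma> j r m \<longrightarrow> compatible \<gamma> (fst (r m)) i j)) \<and>
     (\<forall>i\<in>agents \<gamma>. valid \<gamma> P (\<lambda>r m. front \<gamma> i r m \<longrightarrow> Eventually (going \<gamma> i) r m))"

definition front_set :: "('mem, 'msg, 'x) ctxt \<Rightarrow> ('mem, 'x) run \<Rightarrow> nat \<Rightarrow> agent set" where
  "front_set \<gamma> r m = {i \<in> agents \<gamma>. front \<gamma> i r m}"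

definition depends_only_on_front :: "('mem, 'msg, 'x) ctxt \<Rightarrow> ('mem, 'x) protocol \<Rightarrow> bool" where
  "depends_only_on_front \<gamma> P \<longleftrightarrow>
     (\<forall>i\<in>agents \<gamma>. \<forall>r\<in>runs \<gamma> P. \<forall>r'\<in>runs \<gamma> P. \<forall>m m'.
        front_set \<gamma> r m = front_set \<gamma> r' m' \<longrightarrow> P i (snd (r m) i) = P i (snd (r' m') i))"

definition GO :: "('mem, 'msg, 'x) ctxt \<Rightarrow> ('mem, 'x) run \<Rightarrow> nat \<Rightarrow> agent set" where
  "GO \<gamma> r m = {i \<in> agents \<gamma>. going \<gamma> i r m}"

definition safe_to_go :: "('mem, 'msg, 'x) ctxt \<Rightarrow> agent \<Rightarrow> ('mem, 'x) formula" where
  "safe_to_go \<gamma> i r m \<longleftrightarrow>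
     pos \<gamma> (fst (r m)) i = At 0 \<and>
     (\<forall>j\<in>GO \<gamma> r m \<union> {i}. \<forall>k\<in>GO \<gamma> r m \<union> {i}. j \<noteq> k \<longrightarrow> compatible \<gamma> (fst (r m)) j k)"

definition unnecessary_waiting :: "('mem, 'msg, 'x) ctxt \<Rightarrow> ('mem, 'x) protocol \<Rightarrow> bool" where
  "unnecessary_waiting \<gamma> P \<longleftrightarrow>
     (\<exists>i\<in>agents \<gamma>. \<exists>r\<in>runs \<gamma> P. \<exists>m. safe_to_go \<gamma> i r m \<and> i \<notin> GO \<gamma> r m)"


section \<open>Lexicographic optimality\<close>

definition lex_dominates ::
  "('mem, 'msg, 'x) ctxt \<Rightarrow> ('mem, 'x) protocol \<Rightarrow> ('mem, 'x) protocol \<Rightarrow> bool" where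
  "lex_dominates \<gamma> P P' \<longleftrightarrow>
     (\<forall>r\<in>runs \<gamma> P. \<forall>r'\<in>runs \<gamma> P'. r 0 = r' 0 \<longrightarrow>
        (\<forall>m. GO \<gamma> r m = GO \<gamma> r' m) \<or>
        (\<exists>m. (\<forall>n<m. GO \<gamma> r n = GO \<gamma> r' n) \<and> GO \<gamma> r' m \<subset> GO \<gamma> r m))"

definition strictly_lex_dominates ::
  "('mem, 'msg, 'x) ctxt \<Rightarrow> ('mem, 'x) protocol \<Rightarrow> ('mem, 'x) protocol \<Rightarrow> bool" where
  "strictly_lex_dominates \<gamma> P P' \<longleftrightarrow> lex_dominates \<gamma> P P' \<and> \<not> lex_dominates \<gamma> P' P"

definition lex_optimal :: "('mem, 'msg, 'x) ctxt \<Rightarrow> ('mem, 'x) protocol \<Rightarrow> bool" where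
  "lex_optimal \<gamma> P \<longleftrightarrow>
     intersection_protocol \<gamma> P \<and>
     \<not> (\<exists>P'. intersection_protocol \<gamma> P' \<and> strictly_lex_dominates \<gamma> P' P)"

end

theory Submission
  imports Defs
begin

text \<open>
  Suppose that agent \<open>k\<close> waits unnecessarily when the front, with all its moves, is \<open>V\<close>. Agents at
  the front hear the moves of the whole front, so they can run the protocol \<open>P'\<close> that acts as \<open>P\<close>
  does, except that \<open>k\<close> goes as well when the front is exactly \<open>V\<close>. As long as the sets of going
  agents agree, the queues agree, and at the first difference \<open>P'\<close> lets one more agent go; hence
  \<open>P'\<close> strictly dominates \<open>P\<close>, and it remains to see that \<open>P'\<close> is an intersection protocol.

  Safety: every front with arbitrary moves occurs in a run of \<open>P\<close>, since its agents may all arrive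
  at time 1. So the choice that \<open>P\<close> makes for a front is safe for all moves of its agents.

  Liveness: since \<open>k\<close> goes at \<open>V\<close>, the front is \<open>V\<close> at most once in a run of \<open>P'\<close>. If some agent were
  blocked forever, then from some time on the choices would be those of \<open>P\<close>, and the same fronts
  would occur in a run of \<open>P\<close>, contradicting its liveness.
\<close>

section \<open>Vocabulary: moves, fronts, the modified protocol and the modified adversary\<close>

definition move_of :: "adversary \<Rightarrow> agent \<Rightarrow> move" where
  "move_of \<alpha> i = snd (arrival \<alpha> i)"

definition arrivals :: "('mem, 'msg, 'x) ctxt \<Rightarrow> adversary \<Rightarrow> nat \<Rightarrow> lane \<Rightarrow> agent set" where
  "arrivals \<gamma> \<alpha> t l = {i \<in> agents \<gamma>. fst (arrival \<alpha> i) = t \<and> fst (move_of \<alpha> i) = l}"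

definition front_moves :: "('mem, 'msg, 'x) ctxt \<Rightarrow> env \<Rightarrow> agent \<Rightarrow> move option" where
  "front_moves \<gamma> e i = (if at_front \<gamma> e i then Some (move_of (adv e) i) else None)"

text \<open>The invariant of all runs. The bounds on arrival times separate the agents already
  queued or departed from those still to come, so that no agent enters a queue twice.\<close>

definition wf_env :: "('mem, 'msg, 'x) ctxt \<Rightarrow> env \<Rightarrow> bool" where
  "wf_env \<gamma> e \<longleftrightarrow>
     adv e \<in> model \<gamma> \<and>
     (\<forall>l. distinct (queue e l)) \<and>
     (\<forall>l. \<forall>j\<in>set (queue e l). j \<in> agents \<gamma> \<and> fst (move_of (adv e) j) = l \<and>
        fst (arrival (adv e) j) \<le> clock e \<and> j \<notin> departed e) \<and>
     (\<forall>j\<in>departed e. j \<in> agents \<gamma> \<and> fst (arrival (adv e) j) \<le> clock e)"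

text \<open>
  For a protocol that depends only on the front, all points with front \<open>D\<close> give the same set, so
  one point suffices in the following definition.
\<close>

definition choice ::
  "('mem, 'msg, 'x) ctxt \<Rightarrow> ('mem, 'x) protocol \<Rightarrow> agent set \<Rightarrow> agent set" where
  "choice \<gamma> P D =
     {i \<in> D. \<exists>r\<in>runs \<gamma> P. \<exists>m. front_set \<gamma> r m = D \<and> P i (snd (r m) i) = Go}"

text \<open>The behaviour of \<open>P\<close> is recomputed from the recorded front instead of the
  whole local state, because memories that arise under the new protocol need not arise in runs of
  \<open>P\<close>. The test against \<open>V\<close> compares moves as well as agents, since
  letting \<open>k\<close> go is known to be safe for these moves only.\<close>

definition eager ::
  "('mem, 'msg, 'x) ctxt \<Rightarrow> ('mem, 'x) protocol \<Rightarrow> (agent \<Rightarrow> 'mem \<Rightarrow> agent \<Rightarrow> move option) \<Rightarrow>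
     agent \<Rightarrow> (agent \<Rightarrow> move option) \<Rightarrow> ('mem, 'x) protocol" where
  "eager \<gamma> P recd k V i s =
     (if rd_front (snd s) \<and>
         (i = k \<and> recd i (fst s) = V \<or> i \<in> choice \<gamma> P (dom (recd i (fst s))))
      then Go else Noop)"

text \<open>
  The times \<open>Suc (Suc j)\<close> keep the agents without an entry apart from each other and from those
  that arrive at time 1.
\<close>

definition reschedule ::
  "('mem, 'msg, 'x) ctxt \<Rightarrow> adversary \<Rightarrow> lane \<Rightarrow> (agent \<Rightarrow> nat option) \<Rightarrow> adversary" where
  "reschedule \<gamma> \<alpha> l en = \<alpha>\<lparr>arrival := (\<lambda>j\<in>agents \<gamma>. case en j of
      Some t \<Rightarrow> (Suc t, move_of \<alpha> j)
    | None \<Rightarrow> (Suc (Suc j), l, snd (move_of \<alpha> j)))\<rparr>"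


section \<open>Environment states\<close>

lemma queue_env_step:
  "queue (env_step \<gamma> a e) l =
     (if queue e l \<noteq> [] \<and> a (hd (queue e l)) = Go then tl (queue e l) else queue e l) @
     sorted_list_of_set (arrivals \<gamma> (adv e) (Suc (clock e)) l)"
proof -
  have "{i \<in> agents \<gamma>. \<exists>l'. arrival (adv e) i = (clock e + 1, l, l')} =
      arrivals \<gamma> (adv e) (Suc (clock e)) l"
    by (auto simp: arrivals_def move_of_def prod_eq_iff)
  then show ?thesis by (simp add: env_step_def)
qed

lemma env_step_simps [simp]:
  "adv (env_step \<gamma> a e) = adv e"
  "clock (env_step \<gamma> a e) = Suc (clock e)"
  "departed (env_step \<gamma> a e) = departed e \<union> {i \<in> agents \<gamma>. at_front \<gamma> e i \<and> a i = Go}"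
  by (simp_all add: env_step_def)

locale failure_free_intersection =
  fixes \<gamma> :: "('mem, 'msg, 'x) ctxt"
  assumes ctx: "intersection_context \<gamma>"
    and nf: "no_failures \<gamma>"
begin

lemma model_failure_free: "\<alpha> \<in> model \<gamma> \<Longrightarrow> failure_free \<gamma> \<alpha>"
  using nf by (auto simp: no_failures_def)

lemma model_is_adversary: "\<alpha> \<in> model \<gamma> \<Longrightarrow> is_adversary \<gamma> \<alpha>"
  using model_failure_free failure_free_def by blast

lemma move_of_in:
  assumes "\<alpha> \<in> model \<gamma>" "i \<in> agents \<gamma>"
  shows "fst (move_of \<alpha> i) \<in> in_lanes \<gamma>" "snd (move_of \<alpha> i) \<in> out_lanes \<gamma>"
proof -
  have "arrival \<alpha> i \<in> UNIV \<times> in_lanes \<gamma> \<times> out_lanes \<gamma>"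
    using model_is_adversary[OF assms(1)] assms(2) unfolding is_adversary_def by blast
  then show "fst (move_of \<alpha> i) \<in> in_lanes \<gamma>" "snd (move_of \<alpha> i) \<in> out_lanes \<gamma>"
    by (auto simp: move_of_def)
qed

lemma arrivals_unique:
  assumes "\<alpha> \<in> model \<gamma>" "i \<in> arrivals \<gamma> \<alpha> t l" "j \<in> arrivals \<gamma> \<alpha> t l"
  shows "i = j"
proof (rule ccontr)
  assume "i \<noteq> j"
  then have "fst (snd (arrival \<alpha> i)) \<noteq> fst (snd (arrival \<alpha> j))"
    using model_is_adversary[OF assms(1)] assms(2,3) by (simp add: is_adversary_def arrivals_def)
  then show False using assms(2,3) by (simp add: arrivals_def move_of_def)
qed

lemma arrivals_cases:
  assumes "\<alpha> \<in> model \<gamma>"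
  obtains "arrivals \<gamma> \<alpha> t l = {}" | j where "arrivals \<gamma> \<alpha> t l = {j}"
  using arrivals_unique[OF assms] by blast

lemma wf_envD:
  assumes "wf_env \<gamma> e"
  shows "adv e \<in> model \<gamma>" "distinct (queue e l)"
    "j \<in> set (queue e l) \<Longrightarrow> j \<in> agents \<gamma>"
    "j \<in> set (queue e l) \<Longrightarrow> fst (move_of (adv e) j) = l"
    "j \<in> set (queue e l) \<Longrightarrow> fst (arrival (adv e) j) \<le> clock e"
    "j \<in> set (queue e l) \<Longrightarrow> j \<notin> departed e"
    "j \<in> departed e \<Longrightarrow> j \<in> agents \<gamma>"
    "j \<in> departed e \<Longrightarrow> fst (arrival (adv e) j) \<le> clock e"
  using assms unfolding wf_env_def by blast+

lemma queued_lane: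
  "wf_env \<gamma> e \<Longrightarrow> j \<in> set (queue e l) \<Longrightarrow> l \<in> in_lanes \<gamma>"
  using move_of_in wf_envD by metis

lemma in_queue_at_mem: "in_queue_at \<gamma> e j l p \<Longrightarrow> j \<in> set (queue e l)"
  by (auto simp: in_queue_at_def)

lemma in_queue_at_unique:
  assumes "wf_env \<gamma> e" "in_queue_at \<gamma> e j l p" "in_queue_at \<gamma> e j l' p'"
  shows "l' = l \<and> p' = p"
proof -
  have "j \<in> set (queue e l)" "j \<in> set (queue e l')"
    using assms(2,3) by (simp_all add: in_queue_at_mem)
  then have "l' = l" using wf_envD(4)[OF assms(1)] by blast
  then show ?thesis
    using assms(2,3) wf_envD(2)[OF assms(1)] nth_eq_iff_index_eq unfolding in_queue_at_def by blast
qed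

lemma pos_lane_of:
  assumes "wf_env \<gamma> e" "in_queue_at \<gamma> e j l p"
  shows "pos \<gamma> e j = At p" "lane_of \<gamma> e j = At l"
proof -
  have iq: "in_queue \<gamma> e j" using assms(2) unfolding in_queue_def by blast
  have "(THE p. \<exists>l. in_queue_at \<gamma> e j l p) = p" "(THE l. \<exists>p. in_queue_at \<gamma> e j l p) = l"
    using assms(2) in_queue_at_unique[OF assms] by (intro the_equality; blast)+
  with iq show "pos \<gamma> e j = At p" "lane_of \<gamma> e j = At l"
    by (simp_all add: pos_def lane_of_def)
qed

lemma at_front_in_queue_at:
  assumes "wf_env \<gamma> e"
  shows "at_front \<gamma> e j \<longleftrightarrow> in_queue_at \<gamma> e j (fst (move_of (adv e) j)) 0"
proof
  assume f: "at_front \<gamma> e j"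
  then have "in_queue \<gamma> e j" by (auto simp: at_front_def pos_def split: if_splits)
  then obtain l p where lp: "in_queue_at \<gamma> e j l p" unfolding in_queue_def by blast
  then have "p = 0" using f pos_lane_of(1)[OF assms lp] by (simp add: at_front_def)
  moreover have "l = fst (move_of (adv e) j)"
    using wf_envD(4)[OF assms in_queue_at_mem[OF lp]] by simp
  ultimately show "in_queue_at \<gamma> e j (fst (move_of (adv e) j)) 0" using lp by simp
next
  assume "in_queue_at \<gamma> e j (fst (move_of (adv e) j)) 0"
  then show "at_front \<gamma> e j" using pos_lane_of(1)[OF assms] by (simp add: at_front_def)
qed

lemma at_front_hd:
  assumes "wf_env \<gamma> e"
  shows "at_front \<gamma> e j \<longleftrightarrow>
    queue e (fst (move_of (adv e) j)) \<noteq> [] \<and> hd (queue e (fst (move_of (adv e) j))) = j"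
  unfolding at_front_in_queue_at[OF assms] in_queue_at_def
  using queued_lane[OF assms] by (metis hd_conv_nth hd_in_set length_greater_0_conv)

lemma at_front_agent: "wf_env \<gamma> e \<Longrightarrow> at_front \<gamma> e j \<Longrightarrow> j \<in> agents \<gamma>"
  using at_front_hd wf_envD(3) hd_in_set by metis

lemma hd_at_front:
  assumes "wf_env \<gamma> e" "queue e l \<noteq> []"
  shows "at_front \<gamma> e (hd (queue e l))" "fst (move_of (adv e) (hd (queue e l))) = l"
  using assms at_front_hd wf_envD(4)[OF assms(1)] hd_in_set by metis+

lemma departed_not_front: "wf_env \<gamma> e \<Longrightarrow> j \<in> departed e \<Longrightarrow> \<not> at_front \<gamma> e j"
  using at_front_hd wf_envD(6) hd_in_set by metis

lemma front_lane_of: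
  assumes "wf_env \<gamma> e" "at_front \<gamma> e j"
  shows "lane_of \<gamma> e j = At (fst (move_of (adv e) j))"
  using assms at_front_in_queue_at pos_lane_of(2) by blast

lemma compatible_front:
  assumes "wf_env \<gamma> e" "at_front \<gamma> e i" "at_front \<gamma> e j"
  shows "compatible \<gamma> e i j \<longleftrightarrow> (move_of (adv e) i, move_of (adv e) j) \<in> compat \<gamma>"
  using front_lane_of[OF assms(1,2)] front_lane_of[OF assms(1,3)]
  by (simp add: compatible_def intent_def move_of_def)

text \<open>New arrivals carry the time \<open>Suc (clock e)\<close>, so they are neither queued nor
  departed yet. A departing agent is the head of a queue without repetitions, so it does not occur
  in the tail.\<close>

lemma wf_env_step:
  assumes "wf_env \<gamma> e"
  shows "wf_env \<gamma> (env_step \<gamma> a e)"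
proof -
  let ?e = "env_step \<gamma> a e"
  let ?kept = "\<lambda>l. if queue e l \<noteq> [] \<and> a (hd (queue e l)) = Go then tl (queue e l) else queue e l"
  note wf = wf_envD[OF assms]
  have fin: "finite (arrivals \<gamma> (adv e) t l)" for t l
    by (rule arrivals_cases[OF wf(1), of t l]) auto
  have kept: "set (?kept l) \<subseteq> set (queue e l)" for l
    by (auto dest: list.set_sel(2))
  have new: "j \<notin> set (queue e l')" "j \<notin> departed e"
    if "j \<in> arrivals \<gamma> (adv e) (Suc (clock e)) l" for j l l'
    using that wf(5)[of j l'] wf(8)[of j] by (auto simp: arrivals_def)
  have q: "set (queue ?e l) = set (?kept l) \<union> arrivals \<gamma> (adv e) (Suc (clock e)) l" for l
    by (simp add: queue_env_step fin)
  have "distinct (?kept l)" for l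
    using wf(2)[of l] by (simp add: distinct_tl)
  moreover have "set (?kept l) \<inter> arrivals \<gamma> (adv e) (Suc (clock e)) l = {}" for l
    using new(1) kept[of l] by blast
  ultimately have "distinct (queue ?e l)" for l
    unfolding queue_env_step distinct_append set_sorted_list_of_set[OF fin]
    using distinct_sorted_list_of_set by blast
  moreover have "j \<in> agents \<gamma> \<and> fst (move_of (adv e) j) = l \<and>
      fst (arrival (adv e) j) \<le> Suc (clock e) \<and> j \<notin> departed ?e" if "j \<in> set (queue ?e l)" for j l
  proof (cases "j \<in> arrivals \<gamma> (adv e) (Suc (clock e)) l")
    case True
    then have "\<not> at_front \<gamma> e j" using new at_front_hd[OF assms] hd_in_set by metis
    then show ?thesis using True new(2)[OF True] by (auto simp: arrivals_def)
  next
    case False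
    then have k: "j \<in> set (?kept l)" using that q by blast
    then have j: "j \<in> set (queue e l)" using kept by blast
    have "\<not> (at_front \<gamma> e j \<and> a j = Go)"
    proof
      assume g: "at_front \<gamma> e j \<and> a j = Go"
      then have "queue e l \<noteq> []" "hd (queue e l) = j"
        using at_front_hd[OF assms, of j] wf(4)[OF j] by auto
      then show False using k g wf(2)[of l] by (cases "queue e l") auto
    qed
    then show ?thesis using wf(3-6)[OF j] by auto
  qed
  moreover have "j \<in> agents \<gamma> \<and> fst (arrival (adv e) j) \<le> Suc (clock e)"
    if "j \<in> departed ?e" for j
  proof (cases "j \<in> departed e")
    case True
    then show ?thesis using wf(7,8)[of j] by auto
  next
    case False
    then have "at_front \<gamma> e j" using that by simp
    then have "j \<in> set (queue e (fst (move_of (adv e) j)))"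
      using at_front_hd[OF assms, of j] hd_in_set by metis
    then show ?thesis using wf(3,5) by (simp add: le_SucI)
  qed
  ultimately show ?thesis
    using wf(1) unfolding wf_env_def env_step_simps(1,2) by blast
qed

text \<open>After \<open>Go\<close> the agent is in \<open>departed\<close>, which is disjoint from
  the queues; otherwise it remains the head, because arrivals join at the back.\<close>

lemma at_front_step:
  assumes "wf_env \<gamma> e" "at_front \<gamma> e j"
  shows "at_front \<gamma> (env_step \<gamma> a e) j \<longleftrightarrow> a j \<noteq> Go"
proof
  show "a j \<noteq> Go" if "at_front \<gamma> (env_step \<gamma> a e) j"
    using departed_not_front[OF wf_env_step[OF assms(1)], of j a] that assms at_front_agent by auto
  show "at_front \<gamma> (env_step \<gamma> a e) j" if "a j \<noteq> Go"
    using that assms unfolding at_front_hd[OF assms(1)] at_front_hd[OF wf_env_step[OF assms(1)]]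
    by (simp add: queue_env_step)
qed

text \<open>Only heads of queues are ever dequeued or added to \<open>departed\<close>. Hence the
  set of going agents alone determines the next environment, whatever the local states are.\<close>

lemma env_step_cong:
  assumes "wf_env \<gamma> e" "\<And>i. at_front \<gamma> e i \<Longrightarrow> a i = Go \<longleftrightarrow> b i = Go"
  shows "env_step \<gamma> a e = env_step \<gamma> b e"
proof (rule env.equality)
  show "queue (env_step \<gamma> a e) = queue (env_step \<gamma> b e)"
    using assms(2)[OF hd_at_front(1)[OF assms(1)]] by (auto simp: queue_env_step fun_eq_iff)
qed (use assms(2) in auto)


section \<open>Runs\<close>

lemma run_step: "r \<in> runs \<gamma> Q \<Longrightarrow> fst (r (Suc m)) = env_step \<gamma> (act Q (r m)) (fst (r m))"
  by (simp add: runs_def step_def next_env_def)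

lemma run_init:
  assumes "r \<in> runs \<gamma> Q"
  shows "adv (fst (r 0)) \<in> model \<gamma>" "clock (fst (r 0)) = 0" "queue (fst (r 0)) l = []"
    "departed (fst (r 0)) = {}"
  using assms by (simp_all add: runs_def initial_def)

lemma wf_env_run: "r \<in> runs \<gamma> Q \<Longrightarrow> wf_env \<gamma> (fst (r m))"
  by (induction m) (simp_all add: run_step wf_env_step run_init wf_env_def[of _ "fst (r 0)"])

lemma clock_run: "r \<in> runs \<gamma> Q \<Longrightarrow> clock (fst (r m)) = m"
  by (induction m) (simp_all add: run_step run_init)

lemma adv_run: "r \<in> runs \<gamma> Q \<Longrightarrow> adv (fst (r m)) = adv (fst (r 0))"
  by (induction m) (simp_all add: run_step)

lemma not_front_0: "r \<in> runs \<gamma> Q \<Longrightarrow> \<not> at_front \<gamma> (fst (r 0)) j"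
  by (simp add: at_front_hd[OF wf_env_run] run_init)

lemma sensor_run:
  assumes "r \<in> runs \<gamma> Q" "i \<in> agents \<gamma>"
  shows "snd (snd (r m) i) = sensor \<gamma> i (fst (r m))"
proof (cases m)
  case 0
  have "snd (r 0) i \<in> Init (exch \<gamma>) i \<times> {sensor \<gamma> i (fst (r 0))}"
    using assms by (auto simp: runs_def initial_def)
  then show ?thesis using 0 by auto
next
  case (Suc n)
  have "r (Suc n) = step \<gamma> Q (r n)" using assms(1) by (simp add: runs_def)
  then show ?thesis using Suc assms(2) by (simp add: step_def)
qed

text \<open>An agent leaves the front exactly by performing \<open>Go\<close> there, so the temporal
  definition of \<open>going\<close> reduces to the current action.\<close>

lemma going_iff:
  assumes "r \<in> runs \<gamma> Q"
  shows "going \<gamma> i r m \<longleftrightarrow> at_front \<gamma> (fst (r m)) i \<and> act Q (r m) i = Go"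
  using at_front_step[OF wf_env_run[OF assms]]
  by (auto simp: going_def front_def Next_def run_step[OF assms])

lemma mem_GO_iff:
  assumes "r \<in> runs \<gamma> Q"
  shows "i \<in> GO \<gamma> r m \<longleftrightarrow> at_front \<gamma> (fst (r m)) i \<and> act Q (r m) i = Go"
  using at_front_agent[OF wf_env_run[OF assms]] by (auto simp: GO_def going_iff[OF assms])

lemma mem_front_set:
  assumes "r \<in> runs \<gamma> Q"
  shows "i \<in> front_set \<gamma> r m \<longleftrightarrow> at_front \<gamma> (fst (r m)) i"
  using at_front_agent[OF wf_env_run[OF assms]] by (auto simp: front_set_def front_def)

lemma run_step_GO:
  assumes "r \<in> runs \<gamma> Q"
  shows "fst (r (Suc m)) = env_step \<gamma> (\<lambda>i. if i \<in> GO \<gamma> r m then Go else Noop) (fst (r m))"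
  unfolding run_step[OF assms]
  by (rule env_step_cong[OF wf_env_run[OF assms]]) (simp add: mem_GO_iff[OF assms])

lemma queue_run:
  assumes "r \<in> runs \<gamma> Q"
  shows "queue (fst (r (Suc m))) l =
    (if queue (fst (r m)) l \<noteq> [] \<and> hd (queue (fst (r m)) l) \<in> GO \<gamma> r m
     then tl (queue (fst (r m)) l) else queue (fst (r m)) l) @
    sorted_list_of_set (arrivals \<gamma> (adv (fst (r 0))) (Suc m) l)"
  by (simp add: run_step_GO[OF assms] queue_env_step clock_run[OF assms] adv_run[OF assms, of m])

text \<open>This permits comparing runs of different protocols up to their first difference: the
  local states may diverge before it, but the environments do not.\<close>

lemma runs_same_env:
  assumes "r \<in> runs \<gamma> Q" "r' \<in> runs \<gamma> Q'" "r 0 = r' 0" "\<And>n. n < m \<Longrightarrow> GO \<gamma> r n = GO \<gamma> r' n"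
  shows "fst (r m) = fst (r' m)"
  using assms(4)
proof (induction m)
  case (Suc m)
  then show ?case by (simp add: run_step_GO[OF assms(1)] run_step_GO[OF assms(2)])
qed (simp add: assms(3))

section \<open>The time that an agent spends at the front\<close>

lemma departed_mono:
  assumes "r \<in> runs \<gamma> Q" "m \<le> n"
  shows "departed (fst (r m)) \<subseteq> departed (fst (r n))"
  using assms(2) by (induction rule: dec_induct) (auto simp: run_step[OF assms(1)])

lemma gone_not_front:
  assumes "r \<in> runs \<gamma> Q" "i \<in> GO \<gamma> r m" "m < n"
  shows "\<not> at_front \<gamma> (fst (r n)) i"
proof -
  have "i \<in> departed (fst (r (Suc m)))"
    using assms(2) at_front_agent[OF wf_env_run[OF assms(1)]]
    by (auto simp: run_step[OF assms(1)] mem_GO_iff[OF assms(1)])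
  then have "i \<in> departed (fst (r n))" using departed_mono[OF assms(1), of "Suc m" n] assms(3) by auto
  then show ?thesis using departed_not_front wf_env_run[OF assms(1)] by blast
qed

lemma front_stays:
  assumes "r \<in> runs \<gamma> Q" "at_front \<gamma> (fst (r m)) i" "i \<notin> GO \<gamma> r m"
  shows "at_front \<gamma> (fst (r (Suc m))) i"
  using assms at_front_step[OF wf_env_run[OF assms(1)] assms(2)]
  by (simp add: run_step mem_GO_iff)

text \<open>Leaving the front requires going, and an agent that went never returns, so its times at
  the front form an interval.\<close>

lemma front_convex:
  assumes "r \<in> runs \<gamma> Q" "at_front \<gamma> (fst (r m)) i" "at_front \<gamma> (fst (r n)) i" "m \<le> k" "k \<le> n"
  shows "at_front \<gamma> (fst (r k)) i"
  using assms(4,5)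
proof (induction rule: dec_induct)
  case (step k)
  then have "i \<notin> GO \<gamma> r k" using gone_not_front[OF assms(1), of i k n] assms(3) by auto
  then show ?case using front_stays[OF assms(1)] step by auto
qed (rule assms(2))

section \<open>Existence of runs\<close>

lemma run_from_initial:
  assumes "initial \<gamma> g"
  obtains r where "r \<in> runs \<gamma> Q" "r 0 = g"
proof
  show "(\<lambda>m. (step \<gamma> Q ^^ m) g) \<in> runs \<gamma> Q" using assms by (simp add: runs_def)
qed simp

text \<open>The initial memories are borrowed from \<open>r'\<close>, whose existence shows that the
  sets \<open>Init\<close> are inhabited. The readings are recomputed, since they contain the
  intents given by the new adversary.\<close>

lemma run_with_adversary:
  assumes "r' \<in> runs \<gamma> Q'" "\<alpha> \<in> model \<gamma>"
  obtains r where "r \<in> runs \<gamma> Q" "adv (fst (r 0)) = \<alpha>"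
proof -
  let ?e = "(fst (r' 0))\<lparr>adv := \<alpha>\<rparr>"
  let ?g = "(?e, \<lambda>i\<in>agents \<gamma>. (fst (snd (r' 0) i), sensor \<gamma> i ?e))"
  have "initial \<gamma> (r' 0)" using assms(1) by (simp add: runs_def)
  then have "initial \<gamma> ?g" using assms(2) by (auto simp: initial_def PiE_iff)
  then obtain r where "r \<in> runs \<gamma> Q" "r 0 = ?g" by (rule run_from_initial)
  then show thesis using that by simp
qed


section \<open>Realising fronts in other runs\<close>

text \<open>With an adversary, the model contains every failure-free one that has the same
  transmission environment, so only simultaneous arrivals in one lane must be excluded. Agents with
  an entry are kept apart by \<open>inj\<close>. By the last assumption those of them in lane
  \<open>l\<close> arrive at time 1, before all agents without an entry.\<close>

lemma reschedule_model:
  assumes "\<alpha> \<in> model \<gamma>" "l \<in> in_lanes \<gamma>"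
    and inj: "\<And>i j t. en i = Some t \<Longrightarrow> en j = Some t \<Longrightarrow>
      fst (move_of \<alpha> i) = fst (move_of \<alpha> j) \<Longrightarrow> i = j"
    and l: "\<And>i t. en i = Some t \<Longrightarrow> fst (move_of \<alpha> i) = l \<Longrightarrow> t = 0"
  shows "reschedule \<gamma> \<alpha> l en \<in> model \<gamma>"
proof -
  let ?\<beta> = "reschedule \<gamma> \<alpha> l en"
  have ff: "failure_free \<gamma> \<alpha>" and ad: "is_adversary \<gamma> \<alpha>"
    using assms(1) model_failure_free model_is_adversary by auto
  have "arrival ?\<beta> i \<in> UNIV \<times> in_lanes \<gamma> \<times> out_lanes \<gamma>" if "i \<in> agents \<gamma>" for i
    using that move_of_in[OF assms(1) that] assms(2)
    by (auto simp: reschedule_def mem_Times_iff split: option.split)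
  then have "arrival ?\<beta> \<in> agents \<gamma> \<rightarrow>\<^sub>E UNIV \<times> in_lanes \<gamma> \<times> out_lanes \<gamma>"
    by (auto simp: reschedule_def PiE_iff)
  moreover have "fst (snd (arrival ?\<beta> i)) \<noteq> fst (snd (arrival ?\<beta> j))"
    if "i \<in> agents \<gamma>" "j \<in> agents \<gamma>" "i \<noteq> j" "fst (arrival ?\<beta> i) = fst (arrival ?\<beta> j)" for i j
    using that inj[of i _ j] l[of i] l[of j]
    by (auto simp: reschedule_def split: option.splits)
  ultimately have "is_adversary \<gamma> ?\<beta>"
    using ad by (auto simp: is_adversary_def reschedule_def)
  then have "failure_free \<gamma> ?\<beta>"
    using ff by (simp add: failure_free_def reschedule_def)
  moreover have "transmission ?\<beta> = transmission \<alpha>" by (simp add: reschedule_def)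
  ultimately show ?thesis using nf assms(1) by (auto simp: no_failures_def)
qed

text \<open>Entry \<open>t\<close> becomes arrival time \<open>Suc t\<close> because the queues
  start empty and round 1 appends the arrivals of time 1: an agent with arrival time 0 would never
  be queued.\<close>

lemma arrivals_reschedule:
  "arrivals \<gamma> (reschedule \<gamma> \<alpha> l en) (Suc t) l' =
     {j \<in> agents \<gamma>. en j = Some t \<and> fst (move_of \<alpha> j) = l'} \<union>
     {j \<in> agents \<gamma>. en j = None \<and> t = Suc j \<and> l' = l}"
  by (auto simp: arrivals_def reschedule_def move_of_def split: option.splits)

lemma move_of_reschedule:
  "j \<in> agents \<gamma> \<Longrightarrow> en j = Some t \<Longrightarrow> move_of (reschedule \<gamma> \<alpha> l en) j = move_of \<alpha> j"
  by (simp add: reschedule_def move_of_def)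

lemma front_in_lane:
  assumes "wf_env \<gamma> e"
  shows "{j \<in> agents \<gamma>. at_front \<gamma> e j \<and> fst (move_of (adv e) j) = l} = set (take 1 (queue e l))"
proof (cases "queue e l")
  case Nil
  then show ?thesis using at_front_hd[OF assms] by auto
next
  case (Cons x xs)
  then have "at_front \<gamma> e x" "fst (move_of (adv e) x) = l"
    using hd_at_front[OF assms, of l] by auto
  then show ?thesis using Cons at_front_hd[OF assms] at_front_agent[OF assms] by auto
qed

lemma sorted_list_of_take1: "sorted_list_of_set (set (take 1 xs)) = take 1 (xs :: nat list)"
  by (cases xs) auto

text \<open>Exactly the agents at the front of \<open>e\<close> arrive at time 1, at most one in
  each lane, and they meet empty queues.\<close>

lemma reschedule_first:
  assumes "wf_env \<gamma> e" "r \<in> runs \<gamma> Q" "adv (fst (r 0)) = reschedule \<gamma> (adv e) l en"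
    "\<And>j. en j = Some 0 \<longleftrightarrow> at_front \<gamma> e j"
  shows "queue (fst (r 1)) l' = take 1 (queue e l')"
proof -
  have "arrivals \<gamma> (adv (fst (r 0))) (Suc 0) l' =
      {j \<in> agents \<gamma>. at_front \<gamma> e j \<and> fst (move_of (adv e) j) = l'}"
    unfolding assms(3) arrivals_reschedule using assms(4) by auto
  also have "\<dots> = set (take 1 (queue e l'))" by (rule front_in_lane[OF assms(1)])
  finally show ?thesis
    using queue_run[OF assms(2), of 0 l'] run_init(3)[OF assms(2)]
    by (simp only: sorted_list_of_take1) simp
qed

lemma at_front_iff_hd:
  assumes "wf_env \<gamma> e"
  shows "at_front \<gamma> e j \<longleftrightarrow> (\<exists>l. take 1 (queue e l) = [j])"
proof
  assume "at_front \<gamma> e j"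
  then have "take 1 (queue e (fst (move_of (adv e) j))) = [j]"
    using at_front_hd[OF assms] by (metis One_nat_def take0 take_Suc)
  then show "\<exists>l. take 1 (queue e l) = [j]" ..
next
  assume "\<exists>l. take 1 (queue e l) = [j]"
  then obtain l where l: "take 1 (queue e l) = [j]" ..
  then have "queue e l \<noteq> []" "hd (queue e l) = j" by (cases "queue e l"; simp)+
  then show "at_front \<gamma> e j" using hd_at_front(1)[OF assms] by blast
qed

lemma at_front_cong:
  assumes "wf_env \<gamma> e" "wf_env \<gamma> e'" "\<And>l. take 1 (queue e l) = take 1 (queue e' l)"
  shows "at_front \<gamma> e j \<longleftrightarrow> at_front \<gamma> e' j"
  using assms by (simp add: at_front_iff_hd)

text \<open>The whole front arrives at once and all other agents later, so it is on display at time
  1, before any action of \<open>Q\<close> can matter. The run \<open>r'\<close> supplies the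
  initial memories.\<close>

lemma front_reachable:
  assumes "r' \<in> runs \<gamma> Q'" "wf_env \<gamma> e"
  obtains r where "r \<in> runs \<gamma> Q" "front_moves \<gamma> (fst (r 1)) = front_moves \<gamma> e"
proof -
  define en where "en j = (if at_front \<gamma> e j then Some (0::nat) else None)" for j
  have "0 \<in> in_lanes \<gamma>"
    using ctx by (auto simp: intersection_context_def in_lanes_def)
  moreover have "i = j" if "at_front \<gamma> e i" "at_front \<gamma> e j"
    "fst (move_of (adv e) i) = fst (move_of (adv e) j)" for i j
    using that at_front_hd[OF assms(2)] by metis
  ultimately have "reschedule \<gamma> (adv e) 0 en \<in> model \<gamma>"
    by (intro reschedule_model wf_envD[OF assms(2)]) (auto simp: en_def split: if_splits)
  then obtain r where r: "r \<in> runs \<gamma> Q" "adv (fst (r 0)) = reschedule \<gamma> (adv e) 0 en"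
    using run_with_adversary[OF assms(1)] by blast
  have "queue (fst (r 1)) l' = take 1 (queue e l')" for l'
    by (rule reschedule_first[OF assms(2) r]) (simp add: en_def)
  then have f: "at_front \<gamma> (fst (r 1)) j \<longleftrightarrow> at_front \<gamma> e j" for j
    by (intro at_front_cong wf_env_run[OF r(1)] assms(2)) simp
  have "move_of (adv (fst (r 1))) j = move_of (adv e) j" if "at_front \<gamma> e j" for j
    unfolding adv_run[OF r(1), of 1] r(2)
    by (rule move_of_reschedule[OF at_front_agent[OF assms(2) that]]) (simp add: en_def that)
  with f have "front_moves \<gamma> (fst (r 1)) = front_moves \<gamma> e"
    by (auto simp: front_moves_def fun_eq_iff)
  with r(1) show thesis by (rule that)
qed

lemma dom_front_moves: "r \<in> runs \<gamma> Q \<Longrightarrow> dom (front_moves \<gamma> (fst (r m))) = front_set \<gamma> r m"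
  by (auto simp: front_moves_def mem_front_set split: if_splits)

text \<open>
  In the run of \<open>Q\<close>, every agent arrives exactly when it comes to the front in \<open>r'\<close> (counted from
  \<open>M\<close>); the agents that never do so queue up behind \<open>i\<close>, where they cannot be seen.
\<close>

lemma blocked_front_reachable:
  assumes r': "r' \<in> runs \<gamma> Q'"
    and blocked: "\<And>m. M \<le> m \<Longrightarrow> at_front \<gamma> (fst (r' m)) i"
    and GO': "\<And>m. M \<le> m \<Longrightarrow> GO \<gamma> r' m = H (front_set \<gamma> r' m)"
    and GO: "\<And>r m. r \<in> runs \<gamma> Q \<Longrightarrow> GO \<gamma> r m = H (front_set \<gamma> r m)"
  obtains r where "r \<in> runs \<gamma> Q" "\<And>t. front_set \<gamma> r (Suc t) = front_set \<gamma> r' (M + t)"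
proof -
  define \<alpha> where "\<alpha> = adv (fst (r' 0))"
  define li where "li = fst (move_of \<alpha> i)"
  define fr where "fr j t \<longleftrightarrow> at_front \<gamma> (fst (r' (M + t))) j" for j t
  define en where "en j = (if \<exists>t. fr j t then Some (LEAST t. fr j t) else None)" for j
  note wf' = wf_env_run[OF r']
  have adv': "adv (fst (r' m)) = \<alpha>" for m using adv_run[OF r'] by (simp add: \<alpha>_def)
  have \<alpha>: "\<alpha> \<in> model \<gamma>" using run_init(1)[OF r'] by (simp add: \<alpha>_def)
  have fr_i: "fr i t" for t using blocked by (simp add: fr_def)
  have fr_unique: "j = k" if "fr j t" "fr k t" "fst (move_of \<alpha> j) = fst (move_of \<alpha> k)" for j k t
    using that at_front_hd[OF wf'] unfolding fr_def adv' by metis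
  have en_Some: "en j = Some t \<longleftrightarrow> fr j t \<and> (\<forall>s<t. \<not> fr j s)" for j t
  proof
    assume "en j = Some t"
    then have "\<exists>t. fr j t" "t = (LEAST t. fr j t)"
      unfolding en_def by (metis option.distinct(1), metis option.distinct(1) option.inject)
    then show "fr j t \<and> (\<forall>s<t. \<not> fr j s)" using LeastI_ex not_less_Least by blast
  next
    assume *: "fr j t \<and> (\<forall>s<t. \<not> fr j s)"
    then have "(LEAST t. fr j t) = t" by (intro Least_equality) (auto simp: not_less[symmetric])
    with * show "en j = Some t" by (auto simp: en_def)
  qed
  then have en_fr: "fr j t" if "en j = Some t" for j t using that by blast
  have en_0: "en j = Some 0 \<longleftrightarrow> fr j 0" for j by (simp add: en_Some)
  \<comment> \<open>By convexity, being at the front now but not one step earlier already means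
    being there for the first time. So the entries can be read off two consecutive points, as the
    induction requires.\<close>
  have "\<not> fr j s" if "fr j (Suc t)" "\<not> fr j t" "s \<le> t" for j s t
    using front_convex[OF r', of "M + s" j "M + Suc t" "M + t"] that by (auto simp: fr_def)
  then have en_Suc: "en j = Some (Suc t) \<longleftrightarrow> fr j (Suc t) \<and> \<not> fr j t" for j t
    unfolding en_Some less_Suc_eq_le by blast
  \<comment> \<open>As \<open>i\<close> occupies the front of lane \<open>li\<close> forever, no
    other agent of that lane has an entry. This makes \<open>li\<close> a legitimate place for the
    agents without one.\<close>
  have li_i: "j = i" if "fr j t" "fst (move_of \<alpha> j) = li" for j t
    using fr_unique[OF that(1) fr_i] that(2) by (simp add: li_def)
  have "li \<in> in_lanes \<gamma>"
    using move_of_in(1)[OF \<alpha>] at_front_agent[OF wf'] blocked unfolding li_def by blast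
  moreover have "t = 0" if "en j = Some t" "fst (move_of \<alpha> j) = li" for j t
    using that li_i[OF en_fr[OF that(1)]] en_0[of i] fr_i by auto
  ultimately have "reschedule \<gamma> \<alpha> li en \<in> model \<gamma>"
    using fr_unique[OF en_fr en_fr] by (intro reschedule_model[OF \<alpha>]; blast)
  then obtain r where r: "r \<in> runs \<gamma> Q" "adv (fst (r 0)) = reschedule \<gamma> \<alpha> li en"
    using run_with_adversary[OF r'] by blast
  \<comment> \<open>Outside \<open>li\<close>, a queue of \<open>r\<close> holds at most the front
    agent of \<open>r'\<close>, since each successor arrives only when its predecessor has left.
    Lane \<open>li\<close> may grow behind \<open>i\<close>, so only its head is controlled.\<close>
  have sim: "take 1 (queue (fst (r (Suc t))) l) = take 1 (queue (fst (r' (M + t))) l) \<and>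
      (l \<noteq> li \<longrightarrow> length (queue (fst (r (Suc t))) l) \<le> 1)" for t l
  proof (induction t arbitrary: l)
    case 0
    have "queue (fst (r 1)) l = take 1 (queue (fst (r' M)) l)"
      by (rule reschedule_first[OF wf' r(1)]) (use r(2) en_0 in \<open>auto simp: adv' fr_def\<close>)
    then show ?case by simp
  next
    case (Suc t)
    have "front_set \<gamma> r (Suc t) = front_set \<gamma> r' (M + t)"
      using at_front_cong[OF wf_env_run[OF r(1)] wf'] Suc
      by (auto simp: mem_front_set[OF r(1)] mem_front_set[OF r'])
    then have G: "GO \<gamma> r (Suc t) = GO \<gamma> r' (M + t)" using GO[OF r(1)] GO' by simp
    let ?q = "queue (fst (r (Suc t))) l" and ?q' = "queue (fst (r' (M + t))) l"
    show ?case
    proof (cases "l = li")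
      case True
      have hd': "take 1 (queue (fst (r' (M + s))) li) = [i]" for s
        using fr_i[of s] at_front_hd[OF wf', of "M + s" i] unfolding fr_def adv' li_def
        by (metis One_nat_def take0 take_Suc)
      then have "?q \<noteq> []" "hd ?q = i"
        using Suc[of l] True by (cases ?q; simp)+
      moreover have "i \<notin> GO \<gamma> r' (M + t)"
        using gone_not_front[OF r', of i "M + t" "M + Suc t"] fr_i[of "Suc t"] by (auto simp: fr_def)
      ultimately have "take 1 (queue (fst (r (Suc (Suc t)))) l) = [i]"
        by (cases ?q) (auto simp: queue_run[OF r(1), of "Suc t"] G)
      then show ?thesis using True hd'[of "Suc t"] by simp
    next
      case False
      let ?q2 = "queue (fst (r' (M + Suc t))) l"
      have q: "?q = take 1 ?q'" using Suc[of l] False by auto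
      have front2: "{j \<in> agents \<gamma>. fr j (Suc t) \<and> fst (move_of \<alpha> j) = l} = set (take 1 ?q2)"
        using front_in_lane[OF wf', of "M + Suc t" l] by (simp add: fr_def adv')
      have arr: "arrivals \<gamma> (adv (fst (r 0))) (Suc (Suc t)) l = set (take 1 ?q2) - set (take 1 ?q')"
        unfolding r(2) arrivals_reschedule en_Suc front2[symmetric]
          front_in_lane[OF wf', of "M + t" l, symmetric] adv'
        using False by (auto simp: fr_def)
      \<comment> \<open>If the old head stays, it is the new head and nobody arrives. Otherwise the
        old head, if there was one, cannot return, so any new head is new to the front and arrives
        now.\<close>
      have "take 1 ?q2 = (if ?q' \<noteq> [] \<and> hd ?q' \<in> GO \<gamma> r' (M + t) then [] else take 1 ?q') @
          sorted_list_of_set (set (take 1 ?q2) - set (take 1 ?q'))"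
      proof (cases "?q' \<noteq> [] \<and> hd ?q' \<notin> GO \<gamma> r' (M + t)")
        case True
        then have "take 1 ?q2 = take 1 ?q'"
          using queue_run[OF r', of "M + t" l] by (cases ?q') auto
        then show ?thesis using True by simp
      next
        case F: False
        have "set (take 1 ?q2) \<inter> set (take 1 ?q') = {}"
        proof (cases "?q' = []")
          case True
          then show ?thesis by simp
        next
          case False
          then have "hd ?q' \<in> GO \<gamma> r' (M + t)" using F by simp
          then have "\<not> fr (hd ?q') (Suc t)"
            using gone_not_front[OF r', of "hd ?q'" "M + t" "M + Suc t"] by (simp add: fr_def)
          then have "hd ?q' \<notin> set (take 1 ?q2)" unfolding front2[symmetric] by simp
          then show ?thesis using False by (cases ?q') auto
        qed
        then have "set (take 1 ?q2) - set (take 1 ?q') = set (take 1 ?q2)" by blast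
        moreover have "(if ?q' \<noteq> [] \<and> hd ?q' \<in> GO \<gamma> r' (M + t) then [] else take 1 ?q') = []"
          using F by auto
        ultimately show ?thesis by (simp only: sorted_list_of_take1 append_Nil)
      qed
      moreover have "queue (fst (r (Suc (Suc t)))) l =
        (if ?q' \<noteq> [] \<and> hd ?q' \<in> GO \<gamma> r' (M + t) then [] else take 1 ?q') @
          sorted_list_of_set (set (take 1 ?q2) - set (take 1 ?q'))"
        unfolding queue_run[OF r(1), of "Suc t" l] arr q G by (cases ?q') auto
      ultimately have "queue (fst (r (Suc (Suc t)))) l = take 1 ?q2" by simp
      then show ?thesis by simp
    qed
  qed
  have "front_set \<gamma> r (Suc t) = front_set \<gamma> r' (M + t)" for t
    using at_front_cong[OF wf_env_run[OF r(1)] wf'] sim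
    by (auto simp: mem_front_set[OF r(1)] mem_front_set[OF r'])
  with r(1) show thesis by (rule that)
qed


section \<open>The improved protocol\<close>

lemma GO_choice:
  assumes "depends_only_on_front \<gamma> P" "r \<in> runs \<gamma> P"
  shows "GO \<gamma> r m = choice \<gamma> P (front_set \<gamma> r m)"
proof (rule set_eqI)
  fix i
  show "i \<in> GO \<gamma> r m \<longleftrightarrow> i \<in> choice \<gamma> P (front_set \<gamma> r m)"
    using assms at_front_agent[OF wf_env_run[OF assms(2)]]
    unfolding mem_GO_iff[OF assms(2)] choice_def mem_Collect_eq mem_front_set[OF assms(2)] act_def
      depends_only_on_front_def by metis
qed

text \<open>All front agents broadcast their moves, positions 0 always hear each other, and nothing
  fails, so the record of a front agent is complete; senders not at the front are not recorded. This
  holds for every action protocol, hence for \<open>eager\<close> before it is known to be an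
  intersection protocol.\<close>

lemma recd_front_moves:
  assumes "broadcasts_at_front \<gamma> dec" "records_front \<gamma> dec recd" "action_protocol \<gamma> Q"
    and r: "r \<in> runs \<gamma> Q" and i: "at_front \<gamma> (fst (r m)) i"
  shows "recd i (fst (snd (r m) i)) = front_moves \<gamma> (fst (r m))"
proof -
  \<comment> \<open>The record stems from the round that ends at the point considered; such a round
    exists because nobody is at the front at time 0.\<close>
  obtain n where m: "m = Suc n" using i not_front_0[OF r] by (cases m) auto
  let ?e = "fst (r (Suc n))" and ?\<alpha> = "adv (fst (r n))"
  have wf: "wf_env \<gamma> ?e" by (rule wf_env_run[OF r])
  have e: "next_env \<gamma> Q (r n) = ?e" by (simp add: next_env_def run_step[OF r])
  have adv: "adv ?e = ?\<alpha>" by (simp add: run_step[OF r])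
  have ff: "failure_free \<gamma> ?\<alpha>" using model_failure_free wf_envD(1)[OF wf_env_run[OF r]] by blast
  have ag: "i \<in> agents \<gamma>" using at_front_agent[OF wf] i m by simp
  have msg: "delivered \<gamma> Q (r n) j i b \<longleftrightarrow> broadcast \<gamma> Q (r n) j = Some b"
    if j: "at_front \<gamma> ?e j" for j b
  proof -
    have "in_queue_at \<gamma> ?e j (fst (move_of ?\<alpha> j)) 0" "in_queue_at \<gamma> ?e i (fst (move_of ?\<alpha> i)) 0"
      using j i m at_front_in_queue_at[OF wf] adv by auto
    moreover from this have "((fst (move_of ?\<alpha> j), 0), (fst (move_of ?\<alpha> i), 0)) \<in> transmission ?\<alpha>"
      using ff by (auto simp: in_queue_at_def failure_free_def is_adversary_def transmission_env_def)
    ultimately show ?thesis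
      using ff ag at_front_agent[OF wf j] unfolding delivered_def e failure_free_def by blast
  qed
  have bc: "\<exists>b. broadcast \<gamma> Q (r n) j = Some b \<and> dec b = move_of ?\<alpha> j" if j: "at_front \<gamma> ?e j" for j
  proof -
    obtain b l where "broadcast \<gamma> Q (r n) j = Some b" "lane_of \<gamma> ?e j = At l" "dec b = (l, intent ?e j)"
      using assms(1,3) r j at_front_agent[OF wf j] unfolding broadcasts_at_front_def by blast
    then show ?thesis using front_lane_of[OF wf j] by (auto simp: intent_def move_of_def adv)
  qed
  have "recd i (fst (snd (r (Suc n)) i)) j = Some v \<longleftrightarrow> front_moves \<gamma> ?e j = Some v" for j v
  proof -
    have "recd i (fst (snd (r (Suc n)) i)) j = Some v \<longleftrightarrow>
        at_front \<gamma> ?e j \<and> (\<exists>b. delivered \<gamma> Q (r n) j i b \<and> dec b = v)"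
      using assms(2,3) r ag unfolding records_front_def by blast
    also have "\<dots> \<longleftrightarrow> at_front \<gamma> ?e j \<and> move_of ?\<alpha> j = v"
      using msg bc by (metis option.inject)
    also have "\<dots> \<longleftrightarrow> front_moves \<gamma> ?e j = Some v" by (auto simp: front_moves_def adv)
    finally show ?thesis .
  qed
  then show ?thesis unfolding m by (metis ext option.exhaust)
qed

lemma action_protocol_eager: "action_protocol \<gamma> (eager \<gamma> P recd k V)"
  by (simp add: action_protocol_def eager_def)

text \<open>\<open>V k \<noteq> None\<close> puts \<open>k\<close> at the front whenever the front
  is \<open>V\<close>, so the test \<open>rd_front\<close> never suppresses the additional
  agent.\<close>

lemma GO_eager:
  assumes "broadcasts_at_front \<gamma> dec" "records_front \<gamma> dec recd" "V k \<noteq> None"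
    and r: "r \<in> runs \<gamma> (eager \<gamma> P recd k V)"
  shows "GO \<gamma> r m = choice \<gamma> P (front_set \<gamma> r m) \<union>
    (if front_moves \<gamma> (fst (r m)) = V then {k} else {})"
proof (rule set_eqI)
  fix i
  let ?V = "front_moves \<gamma> (fst (r m))"
  have k: "at_front \<gamma> (fst (r m)) k" if "?V = V"
    using that assms(3) by (auto simp: front_moves_def split: if_splits)
  have "i \<in> GO \<gamma> r m \<longleftrightarrow> at_front \<gamma> (fst (r m)) i \<and>
      (i = k \<and> ?V = V \<or> i \<in> choice \<gamma> P (front_set \<gamma> r m))"
  proof (cases "at_front \<gamma> (fst (r m)) i")
    case True
    have "recd i (fst (snd (r m) i)) = ?V"
      by (rule recd_front_moves[OF assms(1,2) action_protocol_eager r True])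
    moreover have "rd_front (snd (snd (r m) i))"
      using sensor_run[OF r at_front_agent[OF wf_env_run[OF r] True]] True by (simp add: sensor_def)
    ultimately show ?thesis
      using True by (simp add: mem_GO_iff[OF r] act_def eager_def dom_front_moves[OF r])
  qed (simp add: mem_GO_iff[OF r])
  also have "\<dots> \<longleftrightarrow> i \<in> choice \<gamma> P (front_set \<gamma> r m) \<union> (if ?V = V then {k} else {})"
    using k mem_front_set[OF r] by (auto simp: choice_def)
  finally show "i \<in> GO \<gamma> r m \<longleftrightarrow> i \<in> choice \<gamma> P (front_set \<gamma> r m) \<union> (if ?V = V then {k} else {})" .
qed

text \<open>The points of \<open>P\<close> that witness \<open>choice\<close> may give the same
  agents other moves. The front of \<open>r'\<close> is therefore transplanted with its moves into a
  run of \<open>P\<close>, where the safety of \<open>P\<close> applies.\<close>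

lemma choice_compatible:
  assumes P: "intersection_protocol \<gamma> P" "depends_only_on_front \<gamma> P"
    and r': "r' \<in> runs \<gamma> Q"
    and ij: "i \<in> choice \<gamma> P (front_set \<gamma> r' m)" "j \<in> choice \<gamma> P (front_set \<gamma> r' m)" "i \<noteq> j"
  shows "compatible \<gamma> (fst (r' m)) i j"
proof -
  obtain r where r: "r \<in> runs \<gamma> P" "front_moves \<gamma> (fst (r 1)) = front_moves \<gamma> (fst (r' m))"
    using front_reachable[OF r' wf_env_run[OF r']] by blast
  then have fs: "front_set \<gamma> r 1 = front_set \<gamma> r' m" using dom_front_moves r' by metis
  then have "i \<in> GO \<gamma> r 1" "j \<in> GO \<gamma> r 1" using GO_choice[OF P(2) r(1)] ij by simp_all
  then have "compatible \<gamma> (fst (r 1)) i j"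
    using P(1) r(1) \<open>i \<noteq> j\<close> unfolding intersection_protocol_def valid_def GO_def by blast
  moreover have f: "at_front \<gamma> (fst (r' m)) i" "at_front \<gamma> (fst (r' m)) j"
    using ij mem_front_set[OF r'] by (auto simp: choice_def)
  moreover have "at_front \<gamma> (fst (r 1)) i" "at_front \<gamma> (fst (r 1)) j"
    using f fs mem_front_set[OF r(1)] mem_front_set[OF r'] by blast+
  moreover have "move_of (adv (fst (r 1))) x = move_of (adv (fst (r' m))) x"
    if "at_front \<gamma> (fst (r' m)) x" "at_front \<gamma> (fst (r 1)) x" for x
    using fun_cong[OF r(2), of x] that by (simp add: front_moves_def)
  ultimately show ?thesis
    using compatible_front[OF wf_env_run[OF r(1)]] compatible_front[OF wf_env_run[OF r']] by metis
qed

end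


theorem proposition12:
  fixes \<gamma> :: "('mem, 'msg, 'x) ctxt" and P :: "('mem, 'x) protocol"
  assumes "intersection_context \<gamma>"
    and "sufficiently_rich \<gamma>"
    and "no_failures \<gamma>"
    and "intersection_protocol \<gamma> P"
    and "lex_optimal \<gamma> P"
    and "depends_only_on_front \<gamma> P"
  shows "\<not> unnecessary_waiting \<gamma> P"
proof
  interpret failure_free_intersection \<gamma> using assms(1,3) by unfold_locales
  assume "unnecessary_waiting \<gamma> P"
  then obtain k r0 m0 where r0: "r0 \<in> runs \<gamma> P" and safe: "safe_to_go \<gamma> k r0 m0"
    and k: "k \<notin> GO \<gamma> r0 m0" unfolding unnecessary_waiting_def by blast
  obtain dec recd where rich: "broadcasts_at_front \<gamma> dec" "records_front \<gamma> dec recd"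
    using assms(2) unfolding sufficiently_rich_def by blast
  let ?V = "front_moves \<gamma> (fst (r0 m0))"
  let ?P = "eager \<gamma> P recd k ?V"
  have fk: "at_front \<gamma> (fst (r0 m0)) k" using safe by (simp add: safe_to_go_def at_front_def)
  then have Vk: "?V k \<noteq> None" by (simp add: front_moves_def)
  note GO_P = GO_choice[OF assms(6)]
  note GO_P' = GO_eager[where V = ?V and k = k, OF rich Vk]
  have same_front: "front_set \<gamma> r m = front_set \<gamma> r0 m0"
    if "r \<in> runs \<gamma> Q" "front_moves \<gamma> (fst (r m)) = ?V" for r m and Q :: "('mem, 'x) protocol"
    using that dom_front_moves[OF that(1)] dom_front_moves[OF r0] by metis
  \<comment> \<open>These are exactly the agents that \<open>safe_to_go\<close> tests at the waiting
    point, so their compatibility carries over once the moves are seen to agree.\<close>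
  have GO_V: "GO \<gamma> r m = GO \<gamma> r0 m0 \<union> {k}"
    if "r \<in> runs \<gamma> ?P" "front_moves \<gamma> (fst (r m)) = ?V" for r m
    using that GO_P'[OF that(1)] GO_P[OF r0] same_front[OF that] by simp
  have safe': "compatible \<gamma> (fst (r m)) i j"
    if r: "r \<in> runs \<gamma> ?P" and ij: "i \<in> GO \<gamma> r m" "j \<in> GO \<gamma> r m" "i \<noteq> j" for r m i j
  proof (cases "front_moves \<gamma> (fst (r m)) = ?V")
    case True
    have "compatible \<gamma> (fst (r0 m0)) i j"
      using safe ij unfolding GO_V[OF r True] safe_to_go_def by blast
    moreover have f: "at_front \<gamma> (fst (r m)) i" "at_front \<gamma> (fst (r m)) j"
      using ij mem_GO_iff[OF r] by auto
    moreover have "at_front \<gamma> (fst (r0 m0)) i" "at_front \<gamma> (fst (r0 m0)) j"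
      using f same_front[OF r True] mem_front_set[OF r] mem_front_set[OF r0] by blast+
    moreover have "move_of (adv (fst (r m))) x = move_of (adv (fst (r0 m0))) x"
      if "at_front \<gamma> (fst (r m)) x" "at_front \<gamma> (fst (r0 m0)) x" for x
      using fun_cong[OF True, of x] that by (simp add: front_moves_def)
    ultimately show ?thesis
      using compatible_front[OF wf_env_run[OF r]] compatible_front[OF wf_env_run[OF r0]] by metis
  next
    case False
    then show ?thesis
      using choice_compatible[OF assms(4,6) r] ij GO_P'[OF r] by simp
  qed
  have live: "Eventually (going \<gamma> i) r m"
    if r: "r \<in> runs \<gamma> ?P" and i: "i \<in> agents \<gamma>" "front \<gamma> i r m" for r m i
  proof (rule ccontr)
    assume never: "\<not> Eventually (going \<gamma> i) r m"
    then have noGO: "i \<notin> GO \<gamma> r n" if "m \<le> n" for n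
      using that by (auto simp: Eventually_def GO_def)
    have stay: "at_front \<gamma> (fst (r n)) i" if "m \<le> n" for n
      using that
    proof (induction rule: dec_induct)
      case (step n)
      then show ?case using front_stays[OF r] noGO by blast
    qed (use i in \<open>simp add: front_def\<close>)
    have "\<exists>M\<ge>m. \<forall>n\<ge>M. front_moves \<gamma> (fst (r n)) \<noteq> ?V"
    proof (cases "\<exists>n\<ge>m. front_moves \<gamma> (fst (r n)) = ?V")
      case True
      then obtain n where n: "m \<le> n" "front_moves \<gamma> (fst (r n)) = ?V" by blast
      have "front_moves \<gamma> (fst (r n')) \<noteq> ?V" if "Suc n \<le> n'" for n'
      proof
        assume "front_moves \<gamma> (fst (r n')) = ?V"
        then have "at_front \<gamma> (fst (r n')) k" using Vk by (metis front_moves_def)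
        moreover have "k \<in> GO \<gamma> r n" using GO_V[OF r n(2)] by simp
        ultimately show False using gone_not_front[OF r, of k n n'] that by auto
      qed
      then show ?thesis using n(1) by (intro exI[of _ "Suc n"]) auto
    qed blast
    then obtain M where M: "m \<le> M" "\<And>n. M \<le> n \<Longrightarrow> front_moves \<gamma> (fst (r n)) \<noteq> ?V" by blast
    \<comment> \<open>From \<open>M\<close> on the new protocol acts by
      \<open>choice \<gamma> P\<close>, as \<open>P\<close> always does, so this function serves as
      \<open>H\<close>. The fronts reappear from time 1 on, since the queues are empty at time
      0.\<close>
    obtain r1 where r1: "r1 \<in> runs \<gamma> P" "\<And>t. front_set \<gamma> r1 (Suc t) = front_set \<gamma> r (M + t)"
    proof (rule blocked_front_reachable[OF r, of M i "choice \<gamma> P" P])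
      show "at_front \<gamma> (fst (r n)) i" if "M \<le> n" for n using stay M(1) that by simp
      show "GO \<gamma> r n = choice \<gamma> P (front_set \<gamma> r n)" if "M \<le> n" for n
        using GO_P'[OF r] M(2)[OF that] by simp
    qed (use GO_P in auto)
    have "i \<notin> GO \<gamma> r1 (Suc t)" for t
    proof -
      have "GO \<gamma> r1 (Suc t) = GO \<gamma> r (M + t)"
        using GO_P[OF r1(1)] GO_P'[OF r] M(2)[of "M + t"] r1(2)[of t] by simp
      then show ?thesis using noGO M(1) by simp
    qed
    then have "\<not> Eventually (going \<gamma> i) r1 1"
      using i(1) by (auto simp: Eventually_def GO_def Suc_le_eq gr0_conv_Suc)
    moreover have "front \<gamma> i r1 1"
      using r1(2)[of 0] stay[OF M(1)]
      unfolding mem_front_set[OF r, symmetric] front_def mem_front_set[OF r1(1), symmetric] by simp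
    ultimately show False
      using assms(4) r1(1) i(1) unfolding intersection_protocol_def valid_def by blast
  qed
  have "intersection_protocol \<gamma> ?P"
    unfolding intersection_protocol_def valid_def
    using action_protocol_eager live safe' by (auto simp: GO_def going_def)
  \<comment> \<open>On equal environments the new protocol can differ from \<open>P\<close> only by
    adding \<open>k\<close>, so every first difference is a strict gain.\<close>
  moreover have grow: "GO \<gamma> r' m \<subset> GO \<gamma> r m"
    if r: "r \<in> runs \<gamma> ?P" and r': "r' \<in> runs \<gamma> P" and eq: "r 0 = r' 0"
      "\<And>n. n < m \<Longrightarrow> GO \<gamma> r n = GO \<gamma> r' n" and neq: "GO \<gamma> r m \<noteq> GO \<gamma> r' m" for r r' m
  proof -
    have e: "fst (r m) = fst (r' m)" by (rule runs_same_env[OF r r' eq])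
    then have "front_set \<gamma> r m = front_set \<gamma> r' m" by (simp add: front_set_def front_def)
    then show ?thesis
      using neq GO_P'[OF r, of m] GO_P[OF r', of m] by (auto split: if_splits)
  qed
  have "lex_dominates \<gamma> ?P P"
    unfolding lex_dominates_def
  proof (intro ballI impI)
    fix r r' assume r: "r \<in> runs \<gamma> ?P" "r' \<in> runs \<gamma> P" "r 0 = r' 0"
    show "(\<forall>m. GO \<gamma> r m = GO \<gamma> r' m) \<or>
        (\<exists>m. (\<forall>n<m. GO \<gamma> r n = GO \<gamma> r' n) \<and> GO \<gamma> r' m \<subset> GO \<gamma> r m)"
    proof (cases "\<forall>m. GO \<gamma> r m = GO \<gamma> r' m")
      case False
      then obtain m where "GO \<gamma> r m \<noteq> GO \<gamma> r' m" "\<forall>n<m. GO \<gamma> r n = GO \<gamma> r' n"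
        using exists_least_iff[of "\<lambda>m. GO \<gamma> r m \<noteq> GO \<gamma> r' m"] by blast
      then show ?thesis using grow[OF r] by blast
    qed blast
  qed
  moreover have "\<not> lex_dominates \<gamma> P ?P"
  proof
    assume dom: "lex_dominates \<gamma> P ?P"
    have "initial \<gamma> (r0 0)" using r0 by (simp add: runs_def)
    then obtain r where r: "r \<in> runs \<gamma> ?P" "r 0 = r0 0" by (rule run_from_initial)
    \<comment> \<open>By the assumed domination a first difference would be a strict gain for
      \<open>P\<close>, against \<open>grow\<close>. So the runs never differ, and \<open>r\<close>
      reaches the environment of the waiting point, where \<open>k\<close> goes.\<close>
    have "GO \<gamma> r0 m = GO \<gamma> r m" for m
    proof (rule ccontr)
      assume "GO \<gamma> r0 m \<noteq> GO \<gamma> r m"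
      then obtain n where n: "\<forall>n'<n. GO \<gamma> r0 n' = GO \<gamma> r n'" "GO \<gamma> r n \<subset> GO \<gamma> r0 n"
        using dom r0 r unfolding lex_dominates_def by metis
      then have "GO \<gamma> r0 n \<subset> GO \<gamma> r n"
        by (intro grow[OF r(1) r0 r(2)]) auto
      then show False using n(2) by blast
    qed
    moreover from this have "fst (r m0) = fst (r0 m0)"
      by (intro runs_same_env[OF r(1) r0 r(2)]) simp
    then have "GO \<gamma> r m0 = GO \<gamma> r0 m0 \<union> {k}" using GO_V[OF r(1)] by simp
    ultimately show False using k by blast
  qed
  ultimately show False
    using assms(5) unfolding lex_optimal_def strictly_lex_dominates_def by blast
qed

end
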